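(* Let $\mathcal{A} \in \{0,\ast,?\}^{n\times n}$ and $\mathcal{B} \in \{0,\ast,?\}^{n\times m}$ be pattern matrices. Let $\bar{\mathcal{A}}$ be obtained from $\mathcal{A}$ by modifying only its diagonal entries as follows: $\bar{\mathcal{A}}_{ii} = \ast$ if $\mathcal{A}_{ii} = 0$, and $\bar{\mathcal{A}}_{ii} = \;?$ otherwise. Then the structured system $(\mathcal{A},\mathcal{B})$ is controllable (i.e. strongly structurally controllable) if and only if both graphs $G(\begin{bmatrix}\mathcal{A} & \mathcal{B}\end{bmatrix})$ and $G(\begin{bmatrix}\bar{\mathcal{A}} & \mathcal{B}\end{bmatrix})$ are colorable.
   Context: A pattern matrix is a matrix with entries in the set of symbols $\{0,\ast,?\}$. For a $p\times q$ pattern matrix $\mathcal{M}$, its pattern class is $\mathcal{P}(\mathcal{M}) := \{M\in\mathbb{R}^{p\times q} \mid M_{ij}=0 \text{ if } \mathcal{M}_{ij}=0,\ M_{ij}\neq 0 \text{ if } \mathcal{M}_{ij}=\ast\}$; entries with $\mathcal{M}_{ij}=\;?$ are unrestricted. The structured system $(\mathcal{A},\mathcal{B})$ is the family of linear systems $\dot x(t) = Ax(t)+Bu(t)$ with $A\in\mathcal{P}(\mathcal{A})$, $B\in\mathcal{P}(\mathcal{B})$, state $x\in\mathbb{R}^n$ and input $u\in\mathbb{R}^m$. It is called (strongly structurally) controllable if the pair $(A,B)$ is controllable in the usual sense for all $A\in\mathcal{P}(\mathcal{A})$ and $B\in\mathcal{P}(\mathcal{B})$. For $\mathcal{M}\in\{0,\ast,?\}^{p\times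 q}$ with $p\le q$, the directed graph $G(\mathcal{M})=(V,E)$ has node set $V=\{1,2,\ldots,q\}$ and edge set $E\subseteq V\times V$ (self-loops allowed) where $(j,i)\in E$ if and only if $\mathcal{M}_{ij}=\ast$ or $\mathcal{M}_{ij}=\;?$. The edge set is partitioned as $E=E_\ast\cup E_?$, where $(j,i)\in E_\ast$ iff $\mathcal{M}_{ij}=\ast$ and $(j,i)\in E_?$ iff $\mathcal{M}_{ij}=\;?$. If $(i,j)\in E$, then $j$ is called an out-neighbor of $i$ (a node with a self-loop is an out-neighbor of itself). Colorability of $G(\mathcal{M})$ is defined by the following procedure: (1) initially color all nodes white; (2) (color change rule) if a node $i$ (of any color) has exactly one white out-neighbor $j$ and $(i,j)\in E_\ast$, change the color of $j$ to black; (3) repeat step 2 until no more color changes are possible. $G(\mathcal{M})$ is colorable if the nodes $1,2,\ldots,p$ are all colored black following this procedure (nodes $p+1,\ldots,q$ have no incoming edges and always stay white). *)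

theory Defs
  imports "HOL-Analysis.Analysis"
begin

text \<open>\<open>Arb\<close> is the symbol \<open>?\<close>: an unrestricted entry.\<close>

datatype pat = Zero | Star | Arb

definition pattern_class :: "pat ^ 'q ^ 'p \<Rightarrow> (real ^ 'q ^ 'p) set" where
  "pattern_class P =
     {M. \<forall>i j. (P $ i $ j = Zero \<longrightarrow> M $ i $ j = 0) \<and> (P $ i $ j = Star \<longrightarrow> M $ i $ j \<noteq> 0)}"

text \<open>The input is continuous, so that \<open>x\<close> is a classical solution on the whole of \<open>[0, T]\<close>
  (with one-sided derivatives at the end points).\<close>

definition controllable :: "real ^ 'n ^ 'n \<Rightarrow> real ^ 'm ^ 'n \<Rightarrow> bool" where
  "controllable A B \<longleftrightarrow>
     (\<forall>x0 x1. \<exists>T > 0. \<exists>(u :: real \<Rightarrow> real ^ 'm) (x :: real \<Rightarrow> real ^ 'n).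
        continuous_on {0..T} u \<and>
        (\<forall>t \<in> {0..T}. (x has_vector_derivative (A *v x t + B *v u t)) (at t within {0..T})) \<and>
        x 0 = x0 \<and> x T = x1)"

definition strongly_structurally_controllable :: "pat ^ 'n ^ 'n \<Rightarrow> pat ^ 'm ^ 'n \<Rightarrow> bool" where
  "strongly_structurally_controllable \<A> \<B> \<longleftrightarrow>
     (\<forall>A \<in> pattern_class \<A>. \<forall>B \<in> pattern_class \<B>. controllable A B)"

definition hcat :: "'a ^ 'n ^ 'p \<Rightarrow> 'a ^ 'm ^ 'p \<Rightarrow> 'a ^ ('n::finite + 'm::finite) ^ 'p" where
  "hcat M N = (\<chi> i j. case j of Inl k \<Rightarrow> M $ i $ k | Inr k \<Rightarrow> N $ i $ k)"

text \<open>The graph of a pattern matrix with \<open>p\<close> rows and \<open>q = p + r\<close> columns has the column indices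
  as its nodes; row \<open>i\<close> is the node \<open>Inl i\<close>. So \<open>Inl\<close> ranges over the nodes \<open>1, ..., p\<close> and
  \<open>Inr\<close> over the nodes \<open>p + 1, ..., q\<close>. Note the transposition: entry \<open>(i, j)\<close> is
  an edge from \<open>j\<close> to \<open>i\<close>.\<close>

definition star_edges :: "pat ^ ('p::finite + 'r::finite) ^ 'p \<Rightarrow> ('p + 'r) rel" where
  "star_edges P = {(j, Inl i) | i j. P $ i $ j = Star}"

definition arb_edges :: "pat ^ ('p::finite + 'r::finite) ^ 'p \<Rightarrow> ('p + 'r) rel" where
  "arb_edges P = {(j, Inl i) | i j. P $ i $ j = Arb}"

definition edges :: "pat ^ ('p::finite + 'r::finite) ^ 'p \<Rightarrow> ('p + 'r) rel" where
  "edges P = star_edges P \<union> arb_edges P"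

text \<open>A colouring is represented by its set of black nodes; \<open>color_change P S S'\<close> is one
  application of the colour change rule.\<close>

definition color_change ::
  "pat ^ ('p::finite + 'r::finite) ^ 'p \<Rightarrow> ('p + 'r) set \<Rightarrow> ('p + 'r) set \<Rightarrow> bool" where
  "color_change P S S' \<longleftrightarrow>
     (\<exists>i j. {k. (i, k) \<in> edges P \<and> k \<notin> S} = {j} \<and> (i, j) \<in> star_edges P \<and> S' = insert j S)"

text \<open>The rule stays applicable to a node that is the only white out-neighbour of some node along
  a star edge until that node is black, so all exhaustive runs end in the same colouring and it
  does not matter whether one quantifies existentially or universally over them.\<close>

definition colorable :: "pat ^ ('p::finite + 'r::finite) ^ 'p \<Rightarrow> bool" where
  "colorable P \<longleftrightarrow>
     (\<exists>S. (color_change P)\<^sup>*\<^sup>* {} S \<and> \<not> (\<exists>S'. color_change P S S') \<and> range Inl \<subseteq> S)"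

definition bar :: "pat ^ 'n ^ 'n \<Rightarrow> pat ^ 'n ^ 'n" where
  "bar \<A> = (\<chi> i j. if i = j then (if \<A> $ i $ i = Zero then Star else Arb) else \<A> $ i $ j)"

end

theory Submission
  imports Defs "HOL-Computational_Algebra.Fundamental_Theorem_Algebra"
begin

text \<open>The link between graphs and systems is the Hautus condition: for no complex number \<open>l\<close> does
  \<open>A\<close> have a left eigenvector \<open>z \<noteq> 0\<close> for \<open>l\<close> with \<open>z v* B = 0\<close>; equivalently, the rows of
  \<open>[A - l I, B]\<close> are linearly independent. If \<open>A\<close> ranges over the class of \<open>\<A>\<close>, then
  \<open>A - l I\<close> fits the pattern \<open>\<A>\<close> for \<open>l = 0\<close> and the pattern \<open>bar \<A>\<close> for \<open>l \<noteq> 0\<close>, which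
  is why exactly these two graphs occur.

  A colouring run computes with a left kernel vector \<open>z\<close>. If all black coordinates of \<open>z\<close> vanish and
  a column has a single nonzero entry in the white rows, then the coordinate of \<open>z\<close> there
  vanishes too. So a colourable graph makes all matrices fitting its pattern, over any integral
  domain, have trivial left kernel (\<open>colorable_left_kernel_trivial\<close>), and the two colourings
  together give the Hautus condition (\<open>colorable_imp_hautus\<close>). Conversely, when a run is stuck
  with white rows left, no column has exactly one possibly nonzero white entry that is also a star,
  so the white entries of each column can be chosen with sum \<open>0\<close>: the indicator vector of the
  white rows is a real left kernel vector of a matrix in the class (\<open>not_colorable_imp_left_kernel\<close>).
  For the graph of \<open>bar \<A>\<close>, scaling the columns of that matrix turns it into \<open>A - I\<close> with
  \<open>A\<close> in the class of \<open>\<A>\<close>. Either way some system of the family has a real left eigenvector \<open>z\<close>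
  annihilating \<open>B\<close>; along its trajectories \<open>z \<bullet> x\<close> solves a scalar equation without input, so
  they cannot get from \<open>0\<close> to \<open>z\<close> (\<open>left_eigenvector_imp_not_controllable\<close>).

  It remains to see that the Hautus condition implies controllability. If the vectors
  \<open>A\<^sup>k B b\<close> do not span, a nonzero vector orthogonal to all of them generates a cyclic space,
  invariant under right multiplication by \<open>A\<close>, in which the fundamental theorem of algebra provides
  a complex left eigenvector (\<open>hautus_imp_krylov_spans\<close>). If they do span, then it
  suffices to steer each of them to \<open>0\<close> and to superpose; this is done by trajectories that are
  polynomial in time (\<open>krylov_null_controllable\<close>). Reversing time gives the way from \<open>0\<close> to any
  target.\<close>

section \<open>Colourability and left kernels\<close>

text \<open>Pattern classes over an arbitrary ring: the eigenvalues and eigenvectors in the Hautus condition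
  are complex, even though the system matrices are real.\<close>

definition fits :: "pat ^ 'q ^ 'p \<Rightarrow> ('p \<Rightarrow> 'q \<Rightarrow> 'a::zero) \<Rightarrow> bool" where
  "fits P M \<longleftrightarrow> (\<forall>i j. (P $ i $ j = Zero \<longrightarrow> M i j = 0) \<and> (P $ i $ j = Star \<longrightarrow> M i j \<noteq> 0))"

lemma Inl_mem_edges_iff: "(j, Inl i) \<in> edges P \<longleftrightarrow> P $ i $ j \<noteq> Zero"
  by (cases "P $ i $ j") (auto simp: edges_def star_edges_def arb_edges_def)

lemma Inl_mem_star_edges_iff: "(j, Inl i) \<in> star_edges P \<longleftrightarrow> P $ i $ j = Star"
  by (auto simp: star_edges_def)

text \<open>If \<open>r\<close> is the only white out-neighbour of \<open>c\<close>, then in column \<open>c\<close> of \<open>z v* M = 0\<close> every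
  summand except \<open>z r * M r c\<close> is killed either by a zero of \<open>M\<close> or by a zero of \<open>z\<close>, and the star
  makes \<open>M r c\<close> cancellable.\<close>

lemma left_kernel_vanishes_on_black:
  fixes M :: "'p::finite \<Rightarrow> 'p + 'r::finite \<Rightarrow> 'a::idom"
  assumes "(color_change P)\<^sup>*\<^sup>* {} S" "fits P M" "\<And>j. (\<Sum>i\<in>UNIV. z i * M i j) = 0"
  shows "Inl i \<in> S \<Longrightarrow> z i = 0"
  using assms(1)
proof (induction arbitrary: i rule: rtranclp_induct)
  case base
  then show ?case by simp
next
  case (step S S')
  from step.hyps(2) obtain c j where
    white: "{k. (c, k) \<in> edges P \<and> k \<notin> S} = {j}" and star: "(c, j) \<in> star_edges P"
    and S': "S' = insert j S"
    by (auto simp: color_change_def)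
  from star obtain r where j: "j = Inl r" and r: "P $ r $ c = Star"
    by (auto simp: star_edges_def)
  have "z a * M a c = 0" if "a \<noteq> r" for a
  proof (cases "P $ a $ c = Zero")
    case True
    then show ?thesis using assms(2) by (simp add: fits_def)
  next
    case False
    then have "Inl a \<in> S"
      using white that j by (auto simp: Inl_mem_edges_iff[symmetric])
    then show ?thesis using step.IH by simp
  qed
  then have "(\<Sum>a\<in>UNIV. z a * M a c) = (\<Sum>a\<in>{r}. z a * M a c)"
    by (intro sum.mono_neutral_right) auto
  then have "z r * M r c = 0" using assms(3)[of c] by simp
  moreover have "M r c \<noteq> 0" using r assms(2) by (simp add: fits_def)
  ultimately have "z r = 0" by simp
  then show ?case using step.prems step.IH S' j by auto
qed

lemma colorable_left_kernel_trivial: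
  fixes M :: "'p::finite \<Rightarrow> 'p + 'r::finite \<Rightarrow> 'a::idom"
  assumes "colorable P" "fits P M" "\<And>j. (\<Sum>i\<in>UNIV. z i * M i j) = 0"
  shows "z i = 0"
  using assms left_kernel_vanishes_on_black[OF _ assms(2,3)]
  unfolding colorable_def by blast

text \<open>A reachable colouring of greatest cardinality is stuck, because each step adds a node.\<close>

lemma exhaustive_run_exists:
  "\<exists>S. (color_change P)\<^sup>*\<^sup>* {} S \<and> \<not> (\<exists>S'. color_change P S S')"
proof -
  have "\<exists>S. (color_change P)\<^sup>*\<^sup>* {} S \<and> (\<forall>S'. (color_change P)\<^sup>*\<^sup>* {} S' \<longrightarrow> card S' \<le> card S)"
    by (rule ex_has_greatest_nat[where k = "{}" and b = "Suc CARD('a + 'b)"])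
      (simp, metis card_mono finite less_Suc_eq_le top_greatest)
  then obtain S where S: "(color_change P)\<^sup>*\<^sup>* {} S"
    and greatest: "\<And>S'. (color_change P)\<^sup>*\<^sup>* {} S' \<Longrightarrow> card S' \<le> card S" by blast
  have "\<not> color_change P S S'" for S'
  proof
    assume step: "color_change P S S'"
    then obtain j where "j \<notin> S" "S' = insert j S"
      by (auto simp: color_change_def)
    then have "card S' = Suc (card S)" by simp
    moreover have "card S' \<le> card S" using S step by (intro greatest) simp
    ultimately show False by simp
  qed
  then show ?thesis using S by blast
qed

text \<open>The kernel vector is the indicator of the rows that are white when a run gets stuck, so the
  task is to fill the white part of each column with entries of sum \<open>0\<close>. A column without a white star
  is filled with zeros. In a column with a white star \<open>r\<close> there is a second white out-neighbour,
  and the entry at \<open>r\<close> can balance ones at all the others.\<close>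

lemma not_colorable_imp_left_kernel:
  fixes P :: "pat ^ ('p::finite + 'r::finite) ^ 'p"
  assumes "\<not> colorable P"
  obtains M z where "M \<in> pattern_class P" "z \<noteq> 0" "\<And>j. (\<Sum>i\<in>UNIV. z $ i * M $ i $ j) = 0"
proof -
  obtain S where run: "(color_change P)\<^sup>*\<^sup>* {} S" and stuck: "\<not> (\<exists>S'. color_change P S S')"
    using exhaustive_run_exists by blast
  \<comment> \<open>the white out-neighbours of the node \<open>j\<close>\<close>
  define N where "N j = {i. Inl i \<notin> S \<and> P $ i $ j \<noteq> Zero}" for j
  obtain w where w: "Inl w \<notin> S"
    using assms run stuck by (auto simp: colorable_def)
  have column: "\<exists>m. (\<forall>i. (P $ i $ j = Zero \<longrightarrow> m i = 0) \<and> (P $ i $ j = Star \<longrightarrow> m i \<noteq> (0::real))) \<and>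
      (\<Sum>i | Inl i \<notin> S. m i) = 0" for j
  proof (cases "\<exists>r. r \<in> N j \<and> P $ r $ j = Star")
    case False
    then have "\<forall>i. P $ i $ j = Star \<longrightarrow> Inl i \<in> S" by (auto simp: N_def)
    then show ?thesis
      by (intro exI[of _ "\<lambda>i. if P $ i $ j = Star then 1 else 0"]) (auto intro!: sum.neutral)
  next
    case True
    then obtain r where r: "r \<in> N j" "P $ r $ j = Star" by blast
    have "N j \<noteq> {r}"
    proof
      assume N: "N j = {r}"
      have "{k. (j, k) \<in> edges P \<and> k \<notin> S} = Inl ` N j"
        by (auto simp: N_def edges_def star_edges_def arb_edges_def image_iff)
          (metis pat.exhaust)
      then have "color_change P S (insert (Inl r) S)"
        unfolding color_change_def using N r(2)
        by (intro exI[of _ j] exI[of _ "Inl r"]) (simp add: Inl_mem_star_edges_iff)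
      then show False using stuck by blast
    qed
    then have "N j - {r} \<noteq> {}" using r by auto
    then have pos: "card (N j - {r}) > 0" by (simp add: card_gt_0_iff)
    define m where "m i = (if i = r then - real (card (N j - {r}))
      else if P $ i $ j = Zero then 0 else 1)" for i
    have "(\<Sum>i | Inl i \<notin> S. m i) = (\<Sum>i\<in>N j. m i)"
      using r by (intro sum.mono_neutral_right) (auto simp: N_def m_def)
    also have "\<dots> = m r + (\<Sum>i\<in>N j - {r}. m i)"
      using r by (intro sum.remove) auto
    also have "(\<Sum>i\<in>N j - {r}. m i) = (\<Sum>i\<in>N j - {r}. 1)"
      by (intro sum.cong) (auto simp: m_def N_def)
    finally have "(\<Sum>i | Inl i \<notin> S. m i) = 0" by (simp add: m_def)
    moreover have "\<forall>i. (P $ i $ j = Zero \<longrightarrow> m i = 0) \<and> (P $ i $ j = Star \<longrightarrow> m i \<noteq> 0)"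
      using r pos by (auto simp: m_def)
    ultimately show ?thesis by blast
  qed
  then obtain m where m: "\<And>i j. P $ i $ j = Zero \<Longrightarrow> m j i = 0"
    "\<And>i j. P $ i $ j = Star \<Longrightarrow> m j i \<noteq> (0::real)" "\<And>j. (\<Sum>i | Inl i \<notin> S. m j i) = 0"
    by metis
  show thesis
  proof (rule that[of "\<chi> i j. m j i" "\<chi> i. if Inl i \<notin> S then 1 else 0"])
    show "(\<chi> i j. m j i) \<in> pattern_class P" using m by (auto simp: pattern_class_def)
    show "(\<chi> i. if Inl i \<notin> S then 1 else (0 :: real)) \<noteq> 0"
      using w by (auto simp: vec_eq_iff intro!: exI[of _ w])
    show "(\<Sum>i\<in>UNIV. (\<chi> i. if Inl i \<notin> S then 1 else 0) $ i * (\<chi> i j. m j i) $ i $ j) = 0" for j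
    proof -
      have "(\<Sum>i\<in>UNIV. (\<chi> i. if Inl i \<notin> S then 1 else 0) $ i * (\<chi> i j. m j i) $ i $ j)
        = (\<Sum>i\<in>UNIV. if Inl i \<notin> S then m j i else 0)"
        by (intro sum.cong) auto
      also have "\<dots> = (\<Sum>i | Inl i \<notin> S. m j i)"
        by (simp add: sum.If_cases)
      finally show ?thesis using m(3) by simp
    qed
  qed
qed

section \<open>Uncontrollable left eigenvectors\<close>

text \<open>Along a trajectory \<open>z \<bullet> x\<close> satisfies \<open>y' = l y\<close> whatever the input, so if it starts at
  \<open>0\<close> it stays there; but a trajectory from \<open>0\<close> to \<open>z\<close> would end at \<open>z \<bullet> z \<noteq> 0\<close>.\<close>

lemma left_eigenvector_imp_not_controllable:
  fixes A :: "real ^ 'n ^ 'n" and B :: "real ^ 'm ^ 'n"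
  assumes "z \<noteq> 0" "z v* A = l *\<^sub>R z" "z v* B = 0"
  shows "\<not> controllable A B"
proof
  assume "controllable A B"
  then obtain T u x where T: "T > 0" and
    ode: "\<And>t. t \<in> {0..T} \<Longrightarrow> (x has_vector_derivative (A *v x t + B *v u t)) (at t within {0..T})"
    and x: "x 0 = 0" "x T = z"
    unfolding controllable_def by metis
  \<comment> \<open>The integrating factor makes \<open>y\<close> constant.\<close>
  define y where "y t = exp (- l * t) * (z \<bullet> x t)" for t
  have "(y has_real_derivative 0) (at t within {0..T})" if "t \<in> {0..T}" for t
  proof -
    have "((\<lambda>t. z \<bullet> x t) has_vector_derivative z \<bullet> (A *v x t + B *v u t)) (at t within {0..T})"
      using ode[OF that] by (rule bounded_linear.has_vector_derivative[OF bounded_linear_inner_right])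
    also have "z \<bullet> (A *v x t + B *v u t) = l * (z \<bullet> x t)"
      using assms by (simp add: inner_add_right dot_lmul_matrix[symmetric])
    finally show ?thesis
      unfolding y_def has_real_derivative_iff_has_vector_derivative[symmetric]
      by (auto intro!: derivative_eq_intros)
  qed
  then obtain c where "\<forall>t\<in>{0..T}. y t = c"
    using has_field_derivative_zero_constant[of "{0..T}" y] by auto
  then have "y T = y 0" using T by auto
  then show False using x \<open>z \<noteq> 0\<close> by (simp add: y_def)
qed

section \<open>The Hautus condition and the Krylov space\<close>

text \<open>This is the row rank condition on \<open>[A - l I, B]\<close>, phrased through left kernel vectors so that no
  complex matrices have to be formed.\<close>

definition hautus :: "real ^ 'n ^ 'n \<Rightarrow> real ^ 'm ^ 'n \<Rightarrow> bool" where
  "hautus A B \<longleftrightarrow> (\<forall>l z :: 'n \<Rightarrow> complex.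
     (\<forall>j. (\<Sum>i\<in>UNIV. z i * of_real (A $ i $ j)) = l * z j) \<longrightarrow>
     (\<forall>j. (\<Sum>i\<in>UNIV. z i * of_real (B $ i $ j)) = 0) \<longrightarrow> (\<forall>i. z i = 0))"

lemma hautus_uminus: "hautus A B \<Longrightarrow> hautus (- A) (- B)"
  unfolding hautus_def
proof (intro allI impI)
  fix l z i
  assume H: "\<forall>l z. (\<forall>j. (\<Sum>i\<in>UNIV. z i * complex_of_real (A $ i $ j)) = l * z j) \<longrightarrow>
     (\<forall>j. (\<Sum>i\<in>UNIV. z i * complex_of_real (B $ i $ j)) = 0) \<longrightarrow> (\<forall>i. z i = 0)"
    and A: "\<forall>j. (\<Sum>i\<in>UNIV. z i * complex_of_real ((- A) $ i $ j)) = l * z j"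
    and B: "\<forall>j. (\<Sum>i\<in>UNIV. z i * complex_of_real ((- B) $ i $ j)) = 0"
  have "\<forall>j. (\<Sum>i\<in>UNIV. z i * complex_of_real (A $ i $ j)) = (- l) * z j"
    using A by (simp add: sum_negf) (metis minus_minus)
  moreover have "\<forall>j. (\<Sum>i\<in>UNIV. z i * complex_of_real (B $ i $ j)) = 0"
    using B by (simp add: sum_negf)
  ultimately show "z i = 0" using H by blast
qed

text \<open>Otherwise the dimension of the span would grow with each new term, beyond that of the space.\<close>

lemma exists_in_span_of_earlier:
  fixes f :: "nat \<Rightarrow> 'a::euclidean_space"
  shows "\<exists>N. f N \<in> span (f ` {..<N})"
proof (rule ccontr)
  assume "\<not> ?thesis"
  then have new: "f N \<notin> span (f ` {..<N})" for N by blast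
  have "dim (f ` {..<N}) = N" for N
    by (induction N) (use new in \<open>auto simp: lessThan_Suc dim_insert\<close>)
  from this[of "Suc DIM('a)"] dim_subset_UNIV[of "f ` {..<Suc DIM('a)}"]
  show False by simp
qed

lemma span_image_lessThan_sumE:
  fixes f :: "nat \<Rightarrow> 'a::real_vector"
  assumes "y \<in> span (f ` {..<N})"
  obtains c where "y = (\<Sum>k<N. c k *\<^sub>R f k)"
  using assms
proof (induction N arbitrary: y thesis)
  case 0
  then show ?case by simp
next
  case (Suc N)
  then obtain a where "y - a *\<^sub>R f N \<in> span (f ` {..<N})"
    by (auto simp: lessThan_Suc span_insert)
  then obtain c where c: "y - a *\<^sub>R f N = (\<Sum>k<N. c k *\<^sub>R f k)"
    using Suc.IH by blast
  show ?case
  proof (rule Suc.prems(1)[of "c(N := a)"])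
    have "(\<Sum>k<N. (c(N := a)) k *\<^sub>R f k) = (\<Sum>k<N. c k *\<^sub>R f k)"
      by (intro sum.cong) auto
    then show "y = (\<Sum>k<Suc N. (c(N := a)) k *\<^sub>R f k)"
      using c by (simp add: algebra_simps)
  qed
qed

text \<open>Let \<open>N\<close> be least such that \<open>f N\<close> depends linearly on its predecessors, and let the polynomial \<open>p\<close>
  of degree \<open>N\<close> record this dependence, so that \<open>z p(A) = 0\<close>. Split off a complex root,
  \<open>p = (X - l) q\<close>. Then \<open>y = z q(A)\<close> satisfies \<open>y (A - l) = 0\<close>, and it is nonzero because
  \<open>q\<close> has smaller degree than \<open>p\<close>. The conclusion exhibits \<open>y\<close> as a combination of the \<open>f k\<close>, so that
  linear conditions that hold for all \<open>f k\<close> pass to \<open>y\<close>.\<close>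

lemma complex_left_eigenvector_in_cyclic_space:
  fixes A :: "real ^ 'n ^ 'n" and z :: "real ^ 'n"
  assumes "z \<noteq> 0"
  defines "f \<equiv> \<lambda>k. ((\<lambda>v. v v* A) ^^ k) z"
  obtains y q N l where
    "y = (\<lambda>i. \<Sum>k<N. q k * complex_of_real (f k $ i))"
    "\<exists>i. y i \<noteq> 0" "\<And>j. (\<Sum>i\<in>UNIV. y i * of_real (A $ i $ j)) = l * y j"
proof -
  define N where "N = (LEAST N. f N \<in> span (f ` {..<N}))"
  have dep: "f N \<in> span (f ` {..<N})"
    unfolding N_def using exists_in_span_of_earlier by (rule LeastI_ex)
  have indep: "f k \<notin> span (f ` {..<k})" if "k < N" for k
    using not_less_Least that unfolding N_def by blast
  have "f 0 \<noteq> 0" using assms by (simp add: f_def)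
  with dep have "N \<noteq> 0" by (cases N) auto
  then obtain n where n: "N = Suc n" by (cases N) auto
  obtain c where c: "f N = (\<Sum>k<N. c k *\<^sub>R f k)"
    using dep by (rule span_image_lessThan_sumE)
  define p :: "complex poly" where
    "p = monom 1 N - (\<Sum>k<N. monom (of_real (c k)) k)"
  have coeff_p: "coeff p k = (if k = N then 1 else if k < N then - of_real (c k) else 0)" for k
    by (auto simp: p_def coeff_sum)
  have "degree p = N"
  proof (rule antisym)
    show "degree p \<le> N" by (rule degree_le) (simp add: coeff_p)
    show "N \<le> degree p" by (rule le_degree) (simp add: coeff_p)
  qed
  then have "\<not> constant (poly p)"
    using n by (simp add: constant_degree)
  then obtain l where "poly p l = 0"
    using fundamental_theorem_of_algebra by blast
  then obtain q where q: "p = [:- l, 1:] * q"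
    by (auto simp: poly_eq_0_iff_dvd dvd_def)
  have coeff_q: "coeff p (Suc k) = coeff q k - l * coeff q (Suc k)" for k
    unfolding q by (simp add: algebra_simps)
  have coeff_q0: "coeff p 0 = - l * coeff q 0"
    unfolding q by simp
  have "q \<noteq> 0" using q \<open>degree p = N\<close> n by auto
  then have "degree p = Suc (degree q)"
    unfolding q by (subst degree_mult_eq) auto
  then have "degree q = n" using \<open>degree p = N\<close> n by simp
  then have qN: "coeff q N = 0" using n by (intro coeff_eq_0) simp
  have qn: "coeff q n = 1" using coeff_q[of n] qN n by (simp add: coeff_p)
  define y where "y i = (\<Sum>k<N. coeff q k * complex_of_real (f k $ i))" for i
  show thesis
  proof (rule that[of y "coeff q" N l])
    show "y = (\<lambda>i. \<Sum>k<N. coeff q k * complex_of_real (f k $ i))"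
      by (simp add: y_def fun_eq_iff)
    show "\<exists>i. y i \<noteq> 0"
    proof (rule ccontr)
      \<comment> \<open>The \<open>f k\<close> are real, so a complex relation between them yields a real one; it is nontrivial as \<open>q\<close> is monic.\<close>
      assume "\<not> ?thesis"
      then have "Re (y i) = 0" for i by simp
      then have "(\<Sum>k<N. Re (coeff q k) *\<^sub>R f k) = 0"
        by (simp add: vec_eq_iff y_def)
      then have "f n = - (\<Sum>k<n. Re (coeff q k) *\<^sub>R f k)"
        by (simp add: n qn eq_neg_iff_add_eq_0 add.commute)
      also have "\<dots> \<in> span (f ` {..<n})"
        by (intro span_neg span_sum span_scale span_base) auto
      finally show False using indep[of n] n by simp
    qed
    fix j
    have step: "(\<Sum>i\<in>UNIV. complex_of_real (f k $ i) * of_real (A $ i $ j)) = of_real (f (Suc k) $ j)" for k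
      by (simp add: f_def vector_matrix_mult_def mult.commute)
    have "(\<Sum>i\<in>UNIV. y i * of_real (A $ i $ j))
      = (\<Sum>k<N. coeff q k * (\<Sum>i\<in>UNIV. complex_of_real (f k $ i) * of_real (A $ i $ j)))"
      unfolding y_def sum_distrib_left sum_distrib_right
      by (subst sum.swap) (simp add: mult.assoc)
    also have "\<dots> = (\<Sum>k<N. coeff q k * of_real (f (Suc k) $ j))"
      by (simp add: step)
    also have "\<dots> = (\<Sum>k<n. coeff q k * of_real (f (Suc k) $ j)) + of_real (f N $ j)"
      by (simp add: n qn)
    also have "of_real (f N $ j) = (\<Sum>k<N. - coeff p k * complex_of_real (f k $ j))"
      by (simp add: c coeff_p)
    also have "\<dots> = - coeff p 0 * of_real (f 0 $ j)
        + (\<Sum>k<n. - coeff p (Suc k) * of_real (f (Suc k) $ j))"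
      by (simp only: n sum.lessThan_Suc_shift)
    also have "(\<Sum>k<n. coeff q k * of_real (f (Suc k) $ j)) + \<dots> =
      l * coeff q 0 * of_real (f 0 $ j) + (\<Sum>k<n. l * coeff q (Suc k) * of_real (f (Suc k) $ j))"
      by (simp add: coeff_q coeff_q0 sum.distrib[symmetric] algebra_simps)
    also have "\<dots> = (\<Sum>k<N. l * coeff q k * complex_of_real (f k $ j))"
      by (simp only: n sum.lessThan_Suc_shift)
    also have "\<dots> = l * y j"
      by (simp add: y_def sum_distrib_left mult.assoc)
    finally show "(\<Sum>i\<in>UNIV. y i * of_real (A $ i $ j)) = l * y j" .
  qed
qed

definition krylov :: "real ^ 'n ^ 'n \<Rightarrow> real ^ 'm ^ 'n \<Rightarrow> (real ^ 'n) set" where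
  "krylov A B = {((*v) A ^^ k) (B *v b) | k b. True}"

lemma inner_krylov:
  fixes A :: "real ^ 'n ^ 'n"
  shows "z \<bullet> ((*v) A ^^ k) v = ((\<lambda>v. v v* A) ^^ k) z \<bullet> v"
proof (induction k arbitrary: z)
  case (Suc k)
  have "z \<bullet> ((*v) A ^^ Suc k) v = (z v* A) \<bullet> ((*v) A ^^ k) v"
    by (simp add: dot_lmul_matrix)
  also have "\<dots> = ((\<lambda>v. v v* A) ^^ k) (z v* A) \<bullet> v" by (rule Suc.IH)
  finally show ?case by (simp add: funpow_swap1[of "\<lambda>v. v v* A"])
qed simp

text \<open>A vector \<open>z\<close> orthogonal to every \<open>A\<^sup>k B b\<close> has \<open>z A\<^sup>k B = 0\<close> for all \<open>k\<close>, so the complex left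
  eigenvector in the cyclic space of \<open>z\<close> is annihilated by \<open>B\<close> as well.\<close>

lemma hautus_imp_krylov_spans:
  fixes A :: "real ^ 'n ^ 'n" and B :: "real ^ 'm ^ 'n"
  assumes "hautus A B"
  shows "span (krylov A B) = UNIV"
proof (rule ccontr)
  assume "span (krylov A B) \<noteq> UNIV"
  then obtain z where z: "z \<noteq> 0" and orth: "\<forall>x\<in>span (krylov A B). z \<bullet> x = 0"
    using span_not_UNIV_orthogonal by blast
  define f where "f k = ((\<lambda>v. v v* A) ^^ k) z" for k
  have fB: "f k v* B = 0" for k
  proof -
    have "(f k v* B) \<bullet> b = 0" for b
    proof -
      have "z \<bullet> ((*v) A ^^ k) (B *v b) = 0"
        by (intro bspec[OF orth] span_base) (auto simp: krylov_def)
      then show ?thesis by (simp add: inner_krylov f_def dot_lmul_matrix)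
    qed
    from this[of "f k v* B"] show ?thesis by simp
  qed
  obtain y q N l where y: "y = (\<lambda>i. \<Sum>k<N. q k * complex_of_real (f k $ i))"
    and y_nonzero: "\<exists>i. y i \<noteq> 0"
    and yA: "\<And>j. (\<Sum>i\<in>UNIV. y i * of_real (A $ i $ j)) = l * y j"
    by (rule complex_left_eigenvector_in_cyclic_space[OF z, of A, folded f_def]) blast
  have yB: "(\<Sum>i\<in>UNIV. y i * of_real (B $ i $ j)) = 0" for j
  proof -
    have "(\<Sum>i\<in>UNIV. y i * of_real (B $ i $ j))
      = (\<Sum>k<N. q k * (\<Sum>i\<in>UNIV. complex_of_real (f k $ i) * of_real (B $ i $ j)))"
      unfolding y sum_distrib_left sum_distrib_right
      by (subst sum.swap) (simp add: mult.assoc)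
    also have "\<dots> = (\<Sum>k<N. q k * of_real ((f k v* B) $ j))"
      by (simp add: vector_matrix_mult_def mult.commute)
    finally show ?thesis by (simp add: fB)
  qed
  show False
    using assms[unfolded hautus_def, rule_format, of y l] yA yB y_nonzero by blast
qed

section \<open>Steering along polynomial trajectories\<close>

text \<open>Fixing the duration to \<open>1\<close> makes the relation linear: two trajectories can be superposed only
  if they live on the same interval.\<close>

definition steers :: "real ^ 'n ^ 'n \<Rightarrow> real ^ 'm ^ 'n \<Rightarrow> real ^ 'n \<Rightarrow> real ^ 'n \<Rightarrow> bool" where
  "steers A B a b \<longleftrightarrow> (\<exists>u x. continuous_on {0..1} u \<and>
     (\<forall>t\<in>{0..1}. (x has_vector_derivative (A *v x t + B *v u t)) (at t within {0..1})) \<and>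
     x 0 = a \<and> x 1 = b)"

lemma steers_zero: "steers A B 0 0"
  unfolding steers_def
  by (intro exI[of _ "\<lambda>_. 0"]) auto

lemma steers_add:
  assumes "steers A B a b" "steers A B a' b'"
  shows "steers A B (a + a') (b + b')"
proof -
  obtain u x where 1: "continuous_on {0..1} u"
     "\<And>t. t\<in>{0..1} \<Longrightarrow> (x has_vector_derivative (A *v x t + B *v u t)) (at t within {0..1})"
     "x 0 = a" "x 1 = b"
    using assms(1) unfolding steers_def by blast
  obtain u' x' where 2: "continuous_on {0..1} u'"
     "\<And>t. t\<in>{0..1} \<Longrightarrow> (x' has_vector_derivative (A *v x' t + B *v u' t)) (at t within {0..1})"
     "x' 0 = a'" "x' 1 = b'"
    using assms(2) unfolding steers_def by blast
  have "((\<lambda>t. x t + x' t) has_vector_derivative A *v (x t + x' t) + B *v (u t + u' t))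
     (at t within {0..1})" if "t \<in> {0..1}" for t
    using has_vector_derivative_add[OF 1(2)[OF that] 2(2)[OF that]]
    by (simp add: matrix_vector_right_distrib algebra_simps)
  then show ?thesis
    unfolding steers_def using 1 2
    by (intro exI[of _ "\<lambda>t. u t + u' t"] exI[of _ "\<lambda>t. x t + x' t"])
      (auto intro: continuous_on_add)
qed

lemma steers_scale:
  assumes "steers A B a b"
  shows "steers A B (c *\<^sub>R a) (c *\<^sub>R b)"
proof -
  obtain u x where 1: "continuous_on {0..1} u"
     "\<And>t. t\<in>{0..1} \<Longrightarrow> (x has_vector_derivative (A *v x t + B *v u t)) (at t within {0..1})"
     "x 0 = a" "x 1 = b"
    using assms(1) unfolding steers_def by blast
  have "((\<lambda>t. c *\<^sub>R x t) has_vector_derivative A *v (c *\<^sub>R x t) + B *v (c *\<^sub>R u t))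
     (at t within {0..1})" if "t \<in> {0..1}" for t
    using bounded_linear.has_vector_derivative[OF bounded_linear_scaleR_right 1(2)[OF that], of c]
    by (simp add: matrix_vector_mult_scaleR scaleR_add_right)
  then show ?thesis
    unfolding steers_def using 1
    by (intro exI[of _ "\<lambda>t. c *\<^sub>R u t"] exI[of _ "\<lambda>t. c *\<^sub>R x t"])
      (auto intro!: continuous_intros)
qed

lemma subspace_null_controllable: "subspace {a. steers A B a 0}"
  using steers_zero steers_add[of A B _ 0 _ 0] steers_scale[of A B _ 0]
  by (auto simp: subspace_def)

lemma steers_reverse:
  assumes "steers (- A) (- B) a b"
  shows "steers A B b a"
proof -
  have neg: "(- M) *v v = - (M *v v)" for M :: "real ^ 'x ^ 'y" and v
    by (simp add: vec_eq_iff matrix_vector_mult_def sum_negf)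
  obtain u x where 1: "continuous_on {0..1} u"
     "\<And>t. t\<in>{0..1} \<Longrightarrow> (x has_vector_derivative (- A *v x t + - B *v u t)) (at t within {0..1})"
     "x 0 = a" "x 1 = b"
    using assms(1) unfolding steers_def by blast
  have img: "(\<lambda>t. 1 - t) ` {0..1} = {0..1::real}"
    by (auto simp: image_iff intro: bexI[of _ "1 - _"])
  have "((\<lambda>t. x (1 - t)) has_vector_derivative A *v x (1 - t) + B *v u (1 - t))
     (at t within {0..1})" if "t \<in> {0..1}" for t
  proof -
    have d: "((\<lambda>t. 1 - t) has_vector_derivative -1) (at t within {0..1})"
      by (auto intro!: derivative_eq_intros)
    have "(x has_vector_derivative (- A *v x (1 - t) + - B *v u (1 - t)))
        (at (1 - t) within (\<lambda>t. 1 - t) ` {0..1})"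
      unfolding img using that by (intro 1) auto
    from vector_diff_chain_within[OF d this] show ?thesis
      by (simp add: o_def neg add.commute)
  qed
  moreover have "continuous_on {0..1} (\<lambda>t. u (1 - t))"
    by (rule continuous_on_compose2[OF 1(1)]) (auto intro!: continuous_intros)
  ultimately show ?thesis
    unfolding steers_def using 1
    by (intro exI[of _ "\<lambda>t. u (1 - t)"] exI[of _ "\<lambda>t. x (1 - t)"]) auto
qed

lemma pderiv_power_dvd:
  fixes p :: "'a::{comm_ring_1,semiring_no_zero_divisors} poly"
  assumes "r ^ Suc m dvd p"
  shows "r ^ m dvd pderiv p"
proof -
  obtain g where "p = r ^ Suc m * g" using assms by (elim dvdE)
  then show ?thesis
    by (simp only: pderiv_mult pderiv_power_Suc)
      (auto intro!: dvd_add intro: dvd_mult dvd_mult2 dvd_smult simp: mult.assoc)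
qed

text \<open>The coefficient functions of a polynomial trajectory. Let \<open>f j = A\<^sup>j f 0\<close> and
  \<open>f (n + 1) = c 0 f 0 + ... + c n f n\<close>. With \<open>a i = c (n - i)\<close> the recursion is what comparing
  the coefficients of \<open>f 1, ..., f n\<close> in \<open>x' = A x + u f 0\<close> yields for the ansatz
  \<open>x = \<Sum>i\<le>n. w i f (n - i)\<close>, and the coefficient of \<open>f 0\<close> then demands that the input be
  \<open>u = w (n + 1)\<close>. So \<open>v = w 0\<close> is a free parameter that determines both trajectory and input.\<close>

fun chain :: "real poly \<Rightarrow> (nat \<Rightarrow> real) \<Rightarrow> nat \<Rightarrow> real poly" where
  "chain v a 0 = v"
| "chain v a (Suc i) = pderiv (chain v a i) - smult (a i) v"

text \<open>Each step of the recursion costs at most one order of vanishing at a root of \<open>v\<close>. This makes the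
  trajectory end at \<open>0\<close>.\<close>

lemma chain_dvd:
  assumes "r ^ Suc n dvd v" "i \<le> n"
  shows "r ^ (Suc n - i) dvd chain v a i"
  using assms(2)
proof (induction i)
  case 0
  then show ?case using assms(1) by simp
next
  case (Suc i)
  then have "r ^ Suc (n - i) dvd chain v a i" by (simp add: Suc_diff_le)
  then have "r ^ (n - i) dvd pderiv (chain v a i)" by (rule pderiv_power_dvd)
  moreover have "r ^ (n - i) dvd v"
    using assms(1) by (rule power_le_dvd) simp
  ultimately show ?case by (simp add: dvd_diff dvd_smult)
qed

text \<open>If \<open>v\<close> vanishes at time \<open>0\<close> to order exactly \<open>d\<close>, then the next two lemmas say that
  \<open>chain v a i\<close> vanishes there to order exactly \<open>d - i\<close>, since only the derivative lowers the order:
  the subtracted multiple of \<open>v\<close> does not interfere.\<close>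

lemma chain_coeff_below:
  assumes "\<And>l. l < d \<Longrightarrow> coeff v l = 0" "i + l < d"
  shows "coeff (chain v a i) l = 0"
  using assms(2) by (induction i arbitrary: l) (auto simp: assms(1) coeff_pderiv)

lemma chain_coeff_leading:
  assumes "\<And>l. l < d \<Longrightarrow> coeff v l = 0" "coeff v d \<noteq> 0" "i \<le> d"
  shows "coeff (chain v a i) (d - i) \<noteq> 0"
  using assms(3)
proof (induction i)
  case 0
  then show ?case using assms(2) by simp
next
  case (Suc i)
  then have "d - i = Suc (d - Suc i)" by simp
  with Suc show ?case by (simp add: coeff_pderiv assms(1) del: of_nat_Suc)
qed

text \<open>Induction on \<open>k\<close>, with \<open>f j = A\<^sup>j B b\<close>. Some \<open>f (n + 1)\<close> with \<open>n \<ge> k\<close> depends linearly on its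
  predecessors. The polynomial trajectory with parameter \<open>v = t\<^sup>d (1 - t)\<^bsup>n + 1\<^esup>\<close>, where
  \<open>d = n - k\<close>, ends at \<open>0\<close>, and at its start the coefficients of \<open>f n, ..., f (k + 1)\<close>
  vanish while that of \<open>f k\<close> does not. So a combination of \<open>f k\<close> with lower terms \<open>f j\<close> can be
  steered to \<open>0\<close>; the lower terms can by induction, hence so can \<open>f k\<close>. Prescribing the start
  only up to lower terms avoids having to solve an interpolation problem for \<open>v\<close>.\<close>

lemma krylov_null_controllable:
  fixes A :: "real ^ 'n ^ 'n" and B :: "real ^ 'm ^ 'n"
  shows "steers A B (((*v) A ^^ k) (B *v b)) 0"
proof (induction k rule: less_induct)
  case (less k)
  define f where "f k = ((*v) A ^^ k) (B *v b)" for k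
  have f_Suc: "A *v f j = f (Suc j)" for j by (simp add: f_def)
  \<comment> \<open>The dependence is sought among the terms after \<open>f k\<close>, which guarantees \<open>k \<le> n\<close>.\<close>
  obtain N' where "f (Suc k + N') \<in> span ((\<lambda>i. f (Suc k + i)) ` {..<N'})"
    using exists_in_span_of_earlier[of "\<lambda>i. f (Suc k + i)"] by blast
  also have "\<dots> \<subseteq> span (f ` {..<Suc k + N'})"
    by (intro span_mono) auto
  finally obtain n where n: "k \<le> n" "f (Suc n) \<in> span (f ` {..<Suc n})"
    using that[of "k + N'"] by auto
  obtain c where c: "f (Suc n) = (\<Sum>j<Suc n. c j *\<^sub>R f j)"
    using n(2) by (rule span_image_lessThan_sumE)
  define d where "d = n - k"
  define v where "v = monom 1 d * [:1, -1::real:] ^ Suc n"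
  define W where "W = chain v (\<lambda>i. c (n - i))"
  define x where "x t = (\<Sum>i\<le>n. poly (W i) t *\<^sub>R f (n - i))" for t
  define u where "u t = poly (W (Suc n)) t *\<^sub>R b" for t
  have W_Suc: "pderiv (W i) = W (Suc i) + smult (c (n - i)) (W 0)" for i
    by (simp add: W_def)
  have f_top: "(\<Sum>i\<le>n. c (n - i) *\<^sub>R f (n - i)) = f (Suc n)"
    unfolding c lessThan_Suc_atMost
    by (rule sum.nat_diff_reindex[of "\<lambda>j. c j *\<^sub>R f j" "Suc n", simplified lessThan_Suc_atMost, simplified])
  have ode: "(x has_vector_derivative (A *v x t + B *v u t)) (at t within {0..1})" for t
  proof -
    have "(x has_vector_derivative (\<Sum>i\<le>n. poly (pderiv (W i)) t *\<^sub>R f (n - i))) (at t within {0..1})"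
      unfolding x_def
      by (auto intro!: derivative_eq_intros has_vector_derivative_sum)
    also have "(\<Sum>i\<le>n. poly (pderiv (W i)) t *\<^sub>R f (n - i)) =
       (\<Sum>i\<le>n. poly (W (Suc i)) t *\<^sub>R f (n - i)) + poly (W 0) t *\<^sub>R f (Suc n)"
      by (simp add: W_Suc scaleR_add_left sum.distrib f_top[symmetric] scaleR_sum_right mult.commute)
    also have "(\<Sum>i\<le>n. poly (W (Suc i)) t *\<^sub>R f (n - i))
        = (\<Sum>i<n. poly (W (Suc i)) t *\<^sub>R f (n - i)) + poly (W (Suc n)) t *\<^sub>R f 0"
      by (simp add: lessThan_Suc_atMost[symmetric])
    also have "poly (W (Suc n)) t *\<^sub>R f 0 = B *v u t"
      by (simp add: u_def f_def matrix_vector_mult_scaleR)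
    also have "(\<Sum>i<n. poly (W (Suc i)) t *\<^sub>R f (n - i)) + B *v u t + poly (W 0) t *\<^sub>R f (Suc n)
       = (\<Sum>i\<le>n. poly (W i) t *\<^sub>R f (Suc (n - i))) + B *v u t"
      by (simp add: lessThan_Suc_atMost[symmetric] sum.lessThan_Suc_shift Suc_diff_Suc
          del: sum.lessThan_Suc)
    also have "(\<Sum>i\<le>n. poly (W i) t *\<^sub>R f (Suc (n - i))) = A *v x t"
      by (simp add: x_def linear_sum[OF matrix_vector_mul_linear] matrix_vector_mult_scaleR f_Suc)
    finally show ?thesis .
  qed
  have "x 1 = 0"
  proof -
    have "poly (W i) 1 = 0" if "i \<le> n" for i
    proof -
      have "[:1, -1::real:] ^ (Suc n - i) dvd W i"
        unfolding W_def by (rule chain_dvd[OF _ that]) (simp add: v_def)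
      then have "[:1, -1::real:] dvd W i"
        using that by (metis Suc_diff_le dvd_mult_left power_Suc)
      then show ?thesis by (auto elim!: dvdE)
    qed
    then show ?thesis by (simp add: x_def)
  qed
  with ode have start: "steers A B (x 0) 0"
    unfolding steers_def
    by (intro exI[of _ u] exI[of _ x]) (auto simp: u_def intro!: continuous_intros)
  have v: "coeff v l = 0" if "l < d" for l
    using that by (simp add: v_def coeff_monom_mult)
  have vd: "coeff v d \<noteq> 0"
    by (simp add: v_def coeff_monom_mult coeff_0_power)
  have W0: "poly (W i) 0 = 0" if "i < d" for i
    using chain_coeff_below[of d v i 0] v that by (simp add: W_def poly_0_coeff_0)
  have Wd: "poly (W d) 0 \<noteq> 0"
    using chain_coeff_leading[of d v d] v vd by (simp add: W_def poly_0_coeff_0)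
  have "d \<le> n" "n - d = k" using n by (auto simp: d_def)
  have "x 0 = poly (W d) 0 *\<^sub>R f k + (\<Sum>i\<in>{..n} - {d}. poly (W i) 0 *\<^sub>R f (n - i))"
    unfolding x_def using \<open>d \<le> n\<close> \<open>n - d = k\<close> by (subst sum.remove[of _ d]) auto
  then have fk: "f k = inverse (poly (W d) 0) *\<^sub>R
      (x 0 - (\<Sum>i\<in>{..n} - {d}. poly (W i) 0 *\<^sub>R f (n - i)))"
    using Wd by simp
  let ?C = "{a. steers A B a 0}"
  have rest: "poly (W i) 0 *\<^sub>R f (n - i) \<in> ?C" if "i \<in> {..n} - {d}" for i
  proof (cases "i < d")
    case True
    then show ?thesis by (simp add: W0 steers_zero)
  next
    case False
    then have "n - i < k" using that \<open>d \<le> n\<close> \<open>n - d = k\<close> by auto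
    then have "f (n - i) \<in> ?C" using less by (simp add: f_def)
    then show ?thesis by (rule subspace_scale[OF subspace_null_controllable])
  qed
  have "f k \<in> ?C"
    unfolding fk
  proof (intro subspace_scale subspace_diff subspace_null_controllable)
    show "x 0 \<in> ?C" using start by simp
    show "(\<Sum>i\<in>{..n} - {d}. poly (W i) 0 *\<^sub>R f (n - i)) \<in> ?C"
      using rest by (intro subspace_sum subspace_null_controllable)
  qed
  then show ?case by (simp add: f_def)
qed

lemma hautus_imp_controllable:
  fixes A :: "real ^ 'n ^ 'n" and B :: "real ^ 'm ^ 'n"
  assumes "hautus A B"
  shows "controllable A B"
proof -
  have null: "steers A' B' a 0" if "hautus A' B'"
    for A' :: "real ^ 'n ^ 'n" and B' :: "real ^ 'm ^ 'n" and a
  proof -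
    have "span (krylov A' B') \<subseteq> {a. steers A' B' a 0}"
      by (intro span_minimal subspace_null_controllable)
        (auto simp: krylov_def krylov_null_controllable)
    then show ?thesis using hautus_imp_krylov_spans[OF that] by auto
  qed
  have "steers A B x0 x1" for x0 x1
    using steers_add[OF null[OF assms] steers_reverse[OF null[OF hautus_uminus[OF assms]]]]
    by (metis add_0 add_0_right)
  then show ?thesis
    unfolding controllable_def steers_def by (metis zero_less_one)
qed

section \<open>The characterisation\<close>

text \<open>Subtracting \<open>l \<noteq> 0\<close> from the diagonal makes a zero entry nonzero and leaves nothing known about
  any other diagonal entry, which is how \<open>bar\<close> changes a pattern.\<close>

lemma colorable_imp_hautus:
  fixes A :: "real ^ 'n ^ 'n" and B :: "real ^ 'm ^ 'n"
  assumes "colorable (hcat \<A> \<B>)" "colorable (hcat (bar \<A>) \<B>)"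
    and AB: "A \<in> pattern_class \<A>" "B \<in> pattern_class \<B>"
  shows "hautus A B"
  unfolding hautus_def
proof (intro allI impI)
  fix l :: complex and z i
  assume zA: "\<forall>j. (\<Sum>i\<in>UNIV. z i * complex_of_real (A $ i $ j)) = l * z j"
    and zB: "\<forall>j. (\<Sum>i\<in>UNIV. z i * complex_of_real (B $ i $ j)) = 0"
  define M where "M i j = (case j of
    Inl k \<Rightarrow> of_real (A $ i $ k) - (if i = k then l else 0) | Inr k \<Rightarrow> complex_of_real (B $ i $ k))"
    for i j
  have "(\<Sum>i\<in>UNIV. z i * M i j) = 0" for j
  proof (cases j)
    case (Inl k)
    have "(\<Sum>i\<in>UNIV. z i * M i j)
      = (\<Sum>i\<in>UNIV. z i * of_real (A $ i $ k)) - (\<Sum>i\<in>UNIV. if i = k then z i * l else 0)"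
      unfolding sum_subtractf[symmetric] using Inl
      by (intro sum.cong) (auto simp: M_def algebra_simps)
    then show ?thesis using zA by simp
  next
    case (Inr k)
    then show ?thesis using zB by (simp add: M_def)
  qed
  note kernel = colorable_left_kernel_trivial[where M = M and z = z, OF _ _ this]
  show "z i = 0"
  proof (cases "l = 0")
    case True
    then have "fits (hcat \<A> \<B>) M"
      using AB by (auto simp: fits_def hcat_def M_def pattern_class_def split: sum.splits)
    then show ?thesis using kernel assms(1) by blast
  next
    case False
    then have "fits (hcat (bar \<A>) \<B>) M"
      using AB by (auto simp: fits_def hcat_def bar_def M_def pattern_class_def split: sum.splits if_splits)
    then show ?thesis using kernel assms(2) by blast
  qed
qed

lemma controllable_imp_colorable:
  fixes \<A> :: "pat ^ 'n ^ 'n" and \<B> :: "pat ^ 'm ^ 'n"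
  assumes "strongly_structurally_controllable \<A> \<B>"
  shows "colorable (hcat \<A> \<B>)"
proof (rule ccontr)
  assume "\<not> ?thesis"
  then obtain M z where M: "M \<in> pattern_class (hcat \<A> \<B>)" and z: "z \<noteq> 0"
    and zM: "\<And>j. (\<Sum>i\<in>UNIV. z $ i * M $ i $ j) = 0"
    by (rule not_colorable_imp_left_kernel) blast
  define A where "A = (\<chi> i j. M $ i $ Inl j)"
  define B where "B = (\<chi> i j. M $ i $ Inr j)"
  have "A \<in> pattern_class \<A>" "B \<in> pattern_class \<B>"
    using M by (auto simp: pattern_class_def hcat_def A_def B_def split: sum.splits)
  moreover have "z v* A = 0 *\<^sub>R z" "z v* B = 0"
    using zM by (auto simp: vec_eq_iff vector_matrix_mult_def A_def B_def mult.commute)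
  ultimately show False
    using left_eigenvector_imp_not_controllable[OF z] assms
    unfolding strongly_structurally_controllable_def by blast
qed

text \<open>Multiplying a column of a matrix by a nonzero number preserves both its pattern and its left kernel.
  This freedom is used to turn a singular \<open>M\<close> with pattern \<open>bar \<A>\<close> into \<open>A - I\<close> with \<open>A\<close> in the
  class of \<open>\<A>\<close>: the same shift has to fit all columns, and scaling normalises each diagonal
  entry separately. The kernel vector of \<open>M\<close> becomes a left eigenvector of \<open>A\<close> for \<open>1\<close>.\<close>

lemma controllable_imp_colorable_bar:
  fixes \<A> :: "pat ^ 'n ^ 'n" and \<B> :: "pat ^ 'm ^ 'n"
  assumes "strongly_structurally_controllable \<A> \<B>"
  shows "colorable (hcat (bar \<A>) \<B>)"
proof (rule ccontr)
  assume "\<not> ?thesis"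
  then obtain M z where M: "M \<in> pattern_class (hcat (bar \<A>) \<B>)" and z: "z \<noteq> 0"
    and zM: "\<And>j. (\<Sum>i\<in>UNIV. z $ i * M $ i $ j) = 0"
    by (rule not_colorable_imp_left_kernel) blast
  have M': "(bar \<A> $ i $ j = Zero \<longrightarrow> M $ i $ Inl j = 0) \<and> (bar \<A> $ i $ j = Star \<longrightarrow> M $ i $ Inl j \<noteq> 0)" for i j
    using M by (auto simp: pattern_class_def hcat_def split: sum.splits)
  \<comment> \<open>Where \<open>\<A>\<close> has a zero on the diagonal, the scaled entry must be \<open>- 1\<close>; where it has a star, it must not be.\<close>
  define s where "s j = (if \<A> $ j $ j = Zero then - inverse (M $ j $ Inl j)
    else if M $ j $ Inl j = - 1 then 2 else 1)" for j
  have s: "s j \<noteq> 0" for j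
    using M'[of j j] by (auto simp: s_def bar_def)
  define A where "A = (\<chi> i j. s j * M $ i $ Inl j + (if i = j then 1 else 0))"
  define B where "B = (\<chi> i j. M $ i $ Inr j)"
  have diag: "(\<A> $ j $ j = Zero \<longrightarrow> A $ j $ j = 0) \<and> (\<A> $ j $ j = Star \<longrightarrow> A $ j $ j \<noteq> 0)" for j
    using M'[of j j] by (auto simp: A_def s_def bar_def add_eq_0_iff)
  have "(\<A> $ i $ j = Zero \<longrightarrow> A $ i $ j = 0) \<and> (\<A> $ i $ j = Star \<longrightarrow> A $ i $ j \<noteq> 0)" for i j
    using M'[of i j] s[of j] diag[of j] by (cases "i = j") (auto simp: A_def bar_def)
  then have "A \<in> pattern_class \<A>" by (simp add: pattern_class_def)
  moreover have "B \<in> pattern_class \<B>"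
    using M by (auto simp: pattern_class_def hcat_def B_def split: sum.splits)
  moreover have "z v* A = 1 *\<^sub>R z"
  proof -
    have "(\<Sum>i\<in>UNIV. z $ i * A $ i $ j) = z $ j" for j
    proof -
      have "(\<Sum>i\<in>UNIV. z $ i * A $ i $ j)
        = s j * (\<Sum>i\<in>UNIV. z $ i * M $ i $ Inl j) + (\<Sum>i\<in>UNIV. if i = j then z $ i else 0)"
        unfolding sum_distrib_left sum.distrib[symmetric]
        by (intro sum.cong) (auto simp: A_def algebra_simps)
      then show ?thesis by (simp add: zM)
    qed
    then show ?thesis by (simp add: vec_eq_iff vector_matrix_mult_def mult.commute)
  qed
  moreover have "z v* B = 0"
    using zM by (auto simp: vec_eq_iff vector_matrix_mult_def B_def mult.commute)
  ultimately show False
    using left_eigenvector_imp_not_controllable[OF z] assms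
    unfolding strongly_structurally_controllable_def by blast
qed

theorem theorem12:
  fixes \<A> :: "pat ^ 'n ^ 'n" and \<B> :: "pat ^ 'm ^ 'n"
  shows "strongly_structurally_controllable \<A> \<B> \<longleftrightarrow>
    colorable (hcat \<A> \<B>) \<and> colorable (hcat (bar \<A>) \<B>)"
proof
  assume "strongly_structurally_controllable \<A> \<B>"
  then show "colorable (hcat \<A> \<B>) \<and> colorable (hcat (bar \<A>) \<B>)"
    using controllable_imp_colorable controllable_imp_colorable_bar by blast
next
  assume "colorable (hcat \<A> \<B>) \<and> colorable (hcat (bar \<A>) \<B>)"
  then show "strongly_structurally_controllable \<A> \<B>"
    unfolding strongly_structurally_controllable_def
    using colorable_imp_hautus hautus_imp_controllable by blast
qed

end
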